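(* Let $\tau$ be a finite unary vocabulary, $c_\tau := 15|\tau|2^{|\tau|}$, $\mathfrak{M}$ a $\tau$-model of size $n$, and $p \in [0,\frac{1}{2}]$. If $H_S(\mathfrak{M}) < (p-1)\log(1-p) - p\log(p)$, then $C(\mathfrak{M}) < 6np + c_\tau$.
   Context: All logarithms are base 2, with $0\log 0 = 0$. A $\tau$-model of size $n$ has domain $\{1,\dots,n\}$ and interprets each unary symbol as a subset. With the $2^{|\tau|}$ types $\pi_i\subseteq\tau$ and $n_i$ the number of points in exactly the relations named in $\pi_i$, $H_S(\mathfrak{M}) = \sum_i -\frac{n_i}{n}\log\frac{n_i}{n}$. $\mathrm{FO}[\tau]$-formulas are in negation normal form; size counts atomic formulas (negated or not), conjunctions, disjunctions and quantifiers, not negations. $C(\mathfrak{M})$ is the minimum size of an $\mathrm{FO}[\tau]$-sentence true in exactly those $\tau$-models of size $n$ isomorphic to $\mathfrak{M}$.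
   Formalization: The vocabulary τ is assumed nonempty: for empty τ one has c_τ = 0 and H_S = 0, so with n = 1, p = 1/100 the claim would give C(M) < 0.06, which is false since every sentence has size at least 1. *)

theory Defs
  imports Complex_Main
begin

(* Negation normal form: negation occurs only on atoms, which therefore come in
   a positive and a negated version.  Equality is part of the logic. *)

datatype 'p fm =
    Rel 'p nat
  | NRel 'p nat
  | Eq nat nat
  | NEq nat nat
  | Conj "'p fm" "'p fm"
  | Disj "'p fm" "'p fm"
  | Ex nat "'p fm"
  | All nat "'p fm"

primrec fsize :: "'p fm \<Rightarrow> nat" where
  "fsize (Rel P x) = 1"
| "fsize (NRel P x) = 1"
| "fsize (Eq x y) = 1"
| "fsize (NEq x y) = 1"
| "fsize (Conj \<phi> \<psi>) = fsize \<phi> + fsize \<psi> + 1"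
| "fsize (Disj \<phi> \<psi>) = fsize \<phi> + fsize \<psi> + 1"
| "fsize (Ex x \<phi>) = fsize \<phi> + 1"
| "fsize (All x \<phi>) = fsize \<phi> + 1"

primrec free_vars :: "'p fm \<Rightarrow> nat set" where
  "free_vars (Rel P x) = {x}"
| "free_vars (NRel P x) = {x}"
| "free_vars (Eq x y) = {x, y}"
| "free_vars (NEq x y) = {x, y}"
| "free_vars (Conj \<phi> \<psi>) = free_vars \<phi> \<union> free_vars \<psi>"
| "free_vars (Disj \<phi> \<psi>) = free_vars \<phi> \<union> free_vars \<psi>"
| "free_vars (Ex x \<phi>) = free_vars \<phi> - {x}"
| "free_vars (All x \<phi>) = free_vars \<phi> - {x}"

definition sentence :: "'p set \<Rightarrow> 'p fm \<Rightarrow> bool" where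
  "sentence \<tau> \<phi> \<longleftrightarrow> set_fm \<phi> \<subseteq> \<tau> \<and> free_vars \<phi> = {}"

(* A model is given by its size n and its interpretation M; values of M outside
   the vocabulary are irrelevant to every notion below.  As usual in first-order
   logic the domain is nonempty. *)

definition tau_model :: "'p set \<Rightarrow> nat \<Rightarrow> ('p \<Rightarrow> nat set) \<Rightarrow> bool" where
  "tau_model \<tau> n M \<longleftrightarrow> n \<ge> 1 \<and> (\<forall>P\<in>\<tau>. M P \<subseteq> {1..n})"

primrec sat :: "nat \<Rightarrow> ('p \<Rightarrow> nat set) \<Rightarrow> (nat \<Rightarrow> nat) \<Rightarrow> 'p fm \<Rightarrow> bool" where
  "sat n M s (Rel P x) \<longleftrightarrow> s x \<in> M P"
| "sat n M s (NRel P x) \<longleftrightarrow> s x \<notin> M P"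
| "sat n M s (Eq x y) \<longleftrightarrow> s x = s y"
| "sat n M s (NEq x y) \<longleftrightarrow> s x \<noteq> s y"
| "sat n M s (Conj \<phi> \<psi>) \<longleftrightarrow> sat n M s \<phi> \<and> sat n M s \<psi>"
| "sat n M s (Disj \<phi> \<psi>) \<longleftrightarrow> sat n M s \<phi> \<or> sat n M s \<psi>"
| "sat n M s (Ex x \<phi>) \<longleftrightarrow> (\<exists>a\<in>{1..n}. sat n M (s(x := a)) \<phi>)"
| "sat n M s (All x \<phi>) \<longleftrightarrow> (\<forall>a\<in>{1..n}. sat n M (s(x := a)) \<phi>)"

definition true_in :: "nat \<Rightarrow> ('p \<Rightarrow> nat set) \<Rightarrow> 'p fm \<Rightarrow> bool" where
  "true_in n M \<phi> \<longleftrightarrow> (\<forall>s. (\<forall>x. s x \<in> {1..n}) \<longrightarrow> sat n M s \<phi>)"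

definition isomorphic :: "'p set \<Rightarrow> nat \<Rightarrow> ('p \<Rightarrow> nat set) \<Rightarrow> ('p \<Rightarrow> nat set) \<Rightarrow> bool" where
  "isomorphic \<tau> n M N \<longleftrightarrow>
     (\<exists>f. bij_betw f {1..n} {1..n} \<and> (\<forall>P\<in>\<tau>. \<forall>a\<in>{1..n}. a \<in> M P \<longleftrightarrow> f a \<in> N P))"

(* Only models of the same size n are to be told apart; nothing is required of
   the sentence on models of other sizes. *)

definition describes :: "'p set \<Rightarrow> nat \<Rightarrow> ('p \<Rightarrow> nat set) \<Rightarrow> 'p fm \<Rightarrow> bool" where
  "describes \<tau> n M \<phi> \<longleftrightarrow>
     sentence \<tau> \<phi> \<and> (\<forall>N. tau_model \<tau> n N \<longrightarrow> (true_in n N \<phi> \<longleftrightarrow> isomorphic \<tau> n M N))"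

definition complexity :: "'p set \<Rightarrow> nat \<Rightarrow> ('p \<Rightarrow> nat set) \<Rightarrow> nat" where
  "complexity \<tau> n M = (LEAST k. \<exists>\<phi>. describes \<tau> n M \<phi> \<and> fsize \<phi> = k)"

definition type_count :: "'p set \<Rightarrow> nat \<Rightarrow> ('p \<Rightarrow> nat set) \<Rightarrow> 'p set \<Rightarrow> nat" where
  "type_count \<tau> n M \<pi> = card {a \<in> {1..n}. {P \<in> \<tau>. a \<in> M P} = \<pi>}"

(* The convention 0 * log 0 = 0 holds automatically, since the factor 0
   annihilates the (finite) library value of log 2 0. *)

definition entropy :: "'p set \<Rightarrow> nat \<Rightarrow> ('p \<Rightarrow> nat set) \<Rightarrow> real" where
  "entropy \<tau> n M = (\<Sum>\<pi>\<in>Pow \<tau>.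
     - (real (type_count \<tau> n M \<pi>) / real n) * log 2 (real (type_count \<tau> n M \<pi>) / real n))"

definition vocab_const :: "'p set \<Rightarrow> nat" where
  "vocab_const \<tau> = 15 * card \<tau> * 2 ^ card \<tau>"

end

theory Submission imports Defs "HOL-Combinatorics.Permutations" begin

text \<open>Let \<open>r\<close> be the number of points outside a most frequent type. If \<open>r \<le> n/2\<close>, the
  entropy of the model is at least the binary entropy of \<open>r/n\<close>; otherwise every type has frequency
  below \<open>1/2\<close> and the entropy exceeds 1. As the binary entropy is increasing on
  \<open>[0, 1/2]\<close>, the hypothesis forces \<open>r < n p\<close>. On the other hand the model is determined
  by the counts of the other types, and a count \<open>m\<close> can be expressed with size \<open>6 m\<close> plus a
  multiple of \<open>|\<tau>|\<close>, for a total of \<open>6 r\<close> plus a constant.\<close>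

section \<open>Entropy\<close>

text \<open>This is \<open>ln x \<le> x - 1\<close> at \<open>x = v / u\<close>. Summed over two
  distributions, the right-hand sides cancel, which is Gibbs' inequality.\<close>

lemma entropy_term_le:
  fixes u v :: real
  assumes "0 \<le> u" "0 < v"
  shows "u * ln v - u * ln u \<le> v - u"
proof (cases "u = 0")
  case False
  then have "u > 0" using assms by simp
  have "ln (v / u) \<le> v / u - 1" using \<open>u > 0\<close> assms by (intro ln_le_minus_one) simp
  then have "u * ln (v / u) \<le> u * (v / u - 1)" using \<open>u > 0\<close> by (intro mult_left_mono) auto
  then show ?thesis using \<open>u > 0\<close> assms by (simp add: ln_div algebra_simps)
qed (use assms in simp)

definition binary_entropy :: "real \<Rightarrow> real" where
  "binary_entropy x = - x * log 2 x - (1 - x) * log 2 (1 - x)"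

lemma binary_entropy_half: "binary_entropy (1 / 2) = 1"
  by (simp add: binary_entropy_def log_divide)

text \<open>Gibbs' inequality bounds the entropy at \<open>p\<close> by the cross entropy with \<open>x\<close>, which is affine
  in \<open>p\<close> with nonnegative slope.\<close>

lemma binary_entropy_mono:
  assumes "0 \<le> p" "p \<le> x" "x \<le> 1 / 2"
  shows "binary_entropy p \<le> binary_entropy x"
proof (cases "x = 0")
  case False
  then have x: "0 < x" using assms by simp
  have "p * ln x - p * ln p + ((1 - p) * ln (1 - x) - (1 - p) * ln (1 - p)) \<le> 0"
    using entropy_term_le[of p x] entropy_term_le[of "1 - p" "1 - x"] assms x by simp
  \<comment> \<open>The increase of the cross entropy with \<open>x\<close> from \<open>p\<close> to
    \<open>x\<close>; it is nonnegative because \<open>x \<le> 1 - x\<close>.\<close>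
  moreover have "0 \<le> (x - p) * (ln (1 - x) - ln x)"
    using assms x by (intro mult_nonneg_nonneg) auto
  ultimately have "- p * ln p - (1 - p) * ln (1 - p) \<le> - x * ln x - (1 - x) * ln (1 - x)"
    by (simp add: algebra_simps)
  then have "(- p * ln p - (1 - p) * ln (1 - p)) / ln 2 \<le> (- x * ln x - (1 - x) * ln (1 - x)) / ln 2"
    by (intro divide_right_mono) auto
  then show ?thesis by (simp add: binary_entropy_def log_def diff_divide_distrib)
qed (use assms in simp)

text \<open>Each positive weight \<open>f i\<close> carries at least \<open>- log 2 w\<close>, since
  \<open>log\<close> is monotone; zero weights contribute nothing to either side.\<close>

lemma sum_neg_log_ge:
  fixes f :: "'a \<Rightarrow> real"
  assumes "\<And>i. i \<in> A \<Longrightarrow> 0 \<le> f i" "\<And>i. i \<in> A \<Longrightarrow> f i \<le> w"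
  shows "- sum f A * log 2 w \<le> (\<Sum>i\<in>A. - f i * log 2 (f i))"
proof -
  have "(\<Sum>i\<in>A. - f i * log 2 w) \<le> (\<Sum>i\<in>A. - f i * log 2 (f i))"
  proof (rule sum_mono)
    fix i assume "i \<in> A"
    then show "- f i * log 2 w \<le> - f i * log 2 (f i)"
      using assms[of i] by (cases "f i = 0") (auto intro!: mult_left_mono)
  qed
  then show ?thesis by (simp add: sum_distrib_right sum_negf)
qed

lemma entropy_less_imp_mode_large:
  fixes f :: "'a \<Rightarrow> real"
  assumes "finite A" "j \<in> A" and nonneg: "\<And>i. i \<in> A \<Longrightarrow> 0 \<le> f i" and "sum f A = 1"
    and mode: "\<And>i. i \<in> A \<Longrightarrow> f i \<le> f j"
    and p: "0 \<le> p" "p \<le> 1 / 2"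
    and less: "(\<Sum>i\<in>A. - f i * log 2 (f i)) < binary_entropy p"
  shows "1 - f j < p"
proof (rule ccontr)
  assume "\<not> 1 - f j < p"
  then have ge: "p \<le> 1 - f j" by simp
  have rest: "sum f (A - {j}) = 1 - f j"
    using assms by (simp add: sum_diff1)
  show False
  proof (cases "1 - f j \<le> 1 / 2")
    case True
    \<comment> \<open>A single weight is at most the mass outside \<open>j\<close>, so that mass can
      serve as \<open>w\<close>. The effect is to merge all indices other than \<open>j\<close> into
      one, leaving a two-point distribution.\<close>
    have "f i \<le> 1 - f j" if "i \<in> A - {j}" for i
      unfolding rest[symmetric] using that assms by (intro member_le_sum) auto
    then have "- (1 - f j) * log 2 (1 - f j) \<le> (\<Sum>i\<in>A - {j}. - f i * log 2 (f i))"
      using sum_neg_log_ge[of "A - {j}" f "1 - f j"] nonneg rest by auto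
    then have "binary_entropy (1 - f j) \<le> (\<Sum>i\<in>A. - f i * log 2 (f i))"
      using assms(1,2) by (simp add: sum.remove[of A j] binary_entropy_def)
    with binary_entropy_mono[OF p(1) ge True] less show False by simp
  next
    case False
    \<comment> \<open>Positivity has to come first: \<open>log 2 0\<close> is \<open>0\<close>, so
      monotonicity of \<open>log\<close> fails at \<open>0\<close>.\<close>
    have "f j > 0"
    proof (rule ccontr)
      assume "\<not> f j > 0"
      then have "sum f A \<le> 0" using mode by (intro sum_nonpos) fastforce
      then show False using assms by simp
    qed
    then have "log 2 (f j) \<le> log 2 (1 / 2)" using False by simp
    then have "1 \<le> - sum f A * log 2 (f j)" using assms by (simp add: log_divide)
    also have "\<dots> \<le> (\<Sum>i\<in>A. - f i * log 2 (f i))"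
      using nonneg mode by (rule sum_neg_log_ge)
    finally show False
      using less binary_entropy_mono[OF p(1,2) order_refl] binary_entropy_half by simp
  qed
qed

section \<open>Types and isomorphism\<close>

definition elem_type :: "'p set \<Rightarrow> ('p \<Rightarrow> nat set) \<Rightarrow> nat \<Rightarrow> 'p set" where
  "elem_type \<tau> M a = {P \<in> \<tau>. a \<in> M P}"

lemma type_count_eq: "type_count \<tau> n M \<pi> = card {a \<in> {1..n}. elem_type \<tau> M a = \<pi>}"
  by (simp add: type_count_def elem_type_def)

lemma sum_type_count:
  assumes "finite \<tau>"
  shows "(\<Sum>\<pi>\<in>Pow \<tau>. type_count \<tau> n M \<pi>) = n"
proof -
  have "(\<Sum>\<pi>\<in>Pow \<tau>. sum (\<lambda>_. 1::nat) {a \<in> {1..n}. elem_type \<tau> M a = \<pi>}) = sum (\<lambda>_. 1) {1..n}"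
    by (rule sum.group) (use assms in \<open>auto simp: elem_type_def\<close>)
  then show ?thesis by (simp add: type_count_eq)
qed

text \<open>In a unary vocabulary a bijection is an isomorphism iff it preserves the type of every
  point. Conversely, equal counts make the multisets of types equal, and two functions on a finite
  set with the same image multiset differ by a permutation.\<close>

lemma isomorphic_iff_type_count:
  assumes "finite \<tau>"
  shows "isomorphic \<tau> n M N \<longleftrightarrow> (\<forall>\<pi>\<in>Pow \<tau>. type_count \<tau> n N \<pi> = type_count \<tau> n M \<pi>)"
proof
  assume "isomorphic \<tau> n M N"
  then obtain f where f: "bij_betw f {1..n} {1..n}"
    and iff: "\<And>P a. P \<in> \<tau> \<Longrightarrow> a \<in> {1..n} \<Longrightarrow> a \<in> M P \<longleftrightarrow> f a \<in> N P"
    unfolding isomorphic_def by blast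
  have tp: "elem_type \<tau> N (f a) = elem_type \<tau> M a" if "a \<in> {1..n}" for a
    using iff that by (auto simp: elem_type_def)
  have "type_count \<tau> n N \<pi> = type_count \<tau> n M \<pi>" for \<pi>
  proof -
    have "f ` {a \<in> {1..n}. elem_type \<tau> M a = \<pi>} = {a \<in> {1..n}. elem_type \<tau> N a = \<pi>}"
    proof (intro equalityI subsetI)
      fix b assume "b \<in> {a \<in> {1..n}. elem_type \<tau> N a = \<pi>}"
      then obtain a where "a \<in> {1..n}" "b = f a" "elem_type \<tau> N b = \<pi>"
        using bij_betw_imp_surj_on[OF f] by blast
      then show "b \<in> f ` {a \<in> {1..n}. elem_type \<tau> M a = \<pi>}" using tp by auto
    qed (use bij_betw_apply[OF f] tp in auto)
    then have "bij_betw f {a \<in> {1..n}. elem_type \<tau> M a = \<pi>} {a \<in> {1..n}. elem_type \<tau> N a = \<pi>}"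
      using f by (intro bij_betw_subset[OF f]) auto
    then show ?thesis using bij_betw_same_card by (fastforce simp: type_count_eq)
  qed
  then show "\<forall>\<pi>\<in>Pow \<tau>. type_count \<tau> n N \<pi> = type_count \<tau> n M \<pi>" by simp
next
  assume eq: "\<forall>\<pi>\<in>Pow \<tau>. type_count \<tau> n N \<pi> = type_count \<tau> n M \<pi>"
  have cnt: "count (image_mset (elem_type \<tau> K) (mset_set {1..n})) \<pi> = type_count \<tau> n K \<pi>" for K \<pi>
    by (auto simp: count_image_mset type_count_eq vimage_def Int_def intro!: arg_cong[where f = card])
  have zero: "type_count \<tau> n K \<pi> = 0" if "\<pi> \<notin> Pow \<tau>" for K \<pi>
    using that by (auto simp: type_count_eq elem_type_def)
  have "image_mset (elem_type \<tau> M) (mset_set {1..n}) = image_mset (elem_type \<tau> N) (mset_set {1..n})"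
  proof (rule multiset_eqI)
    fix \<pi>
    show "count (image_mset (elem_type \<tau> M) (mset_set {1..n})) \<pi> =
          count (image_mset (elem_type \<tau> N) (mset_set {1..n})) \<pi>"
      unfolding cnt using eq zero by (cases "\<pi> \<in> Pow \<tau>") auto
  qed
  then obtain f where f: "f permutes {1..n}" "\<And>a. a \<in> {1..n} \<Longrightarrow> elem_type \<tau> M a = elem_type \<tau> N (f a)"
    by (rule image_mset_eq_implies_permutes[OF finite_atLeastAtMost]) blast
  have "a \<in> M P \<longleftrightarrow> f a \<in> N P" if "P \<in> \<tau>" "a \<in> {1..n}" for P a
    using f(2)[OF that(2)] that(1) by (auto simp: elem_type_def)
  then show "isomorphic \<tau> n M N"
    unfolding isomorphic_def using permutes_imp_bij[OF f(1)] by blast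
qed

section \<open>Counting formulas\<close>

text \<open>Negation is pushed to the atoms by duality. As negated atoms cost no more than plain
  ones, the size is unchanged.\<close>

primrec neg :: "'p fm \<Rightarrow> 'p fm" where
  "neg (Rel P x) = NRel P x"
| "neg (NRel P x) = Rel P x"
| "neg (Eq x y) = NEq x y"
| "neg (NEq x y) = Eq x y"
| "neg (Conj \<phi> \<psi>) = Disj (neg \<phi>) (neg \<psi>)"
| "neg (Disj \<phi> \<psi>) = Conj (neg \<phi>) (neg \<psi>)"
| "neg (Ex x \<phi>) = All x (neg \<phi>)"
| "neg (All x \<phi>) = Ex x (neg \<phi>)"

lemma sat_neg: "sat n N s (neg \<phi>) \<longleftrightarrow> \<not> sat n N s \<phi>"
  by (induction \<phi> arbitrary: s) auto

lemma neg_simps [simp]: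
  "fsize (neg \<phi>) = fsize \<phi>" "free_vars (neg \<phi>) = free_vars \<phi>" "set_fm (neg \<phi>) = set_fm \<phi>"
  by (induction \<phi>) auto

lemma foldr_Disj_simps:
  "sat n N s (foldr Disj fs b) \<longleftrightarrow> (\<exists>\<phi>\<in>set fs. sat n N s \<phi>) \<or> sat n N s b"
  "fsize (foldr Disj fs b) = (\<Sum>\<phi>\<leftarrow>fs. fsize \<phi> + 1) + fsize b"
  "free_vars (foldr Disj fs b) = (\<Union>\<phi>\<in>set fs. free_vars \<phi>) \<union> free_vars b"
  "set_fm (foldr Disj fs b) = (\<Union>\<phi>\<in>set fs. set_fm \<phi>) \<union> set_fm b"
  by (induction fs) auto

lemma foldr_Conj_simps:
  "sat n N s (foldr Conj fs b) \<longleftrightarrow> (\<forall>\<phi>\<in>set fs. sat n N s \<phi>) \<and> sat n N s b"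
  "fsize (foldr Conj fs b) = (\<Sum>\<phi>\<leftarrow>fs. fsize \<phi> + 1) + fsize b"
  "free_vars (foldr Conj fs b) = (\<Union>\<phi>\<in>set fs. free_vars \<phi>) \<union> free_vars b"
  "set_fm (foldr Conj fs b) = (\<Union>\<phi>\<in>set fs. set_fm \<phi>) \<union> set_fm b"
  by (induction fs) auto

text \<open>The bound variables start at \<open>1\<close>, which keeps variable \<open>0\<close> for
  the point that is tested against them.\<close>

primrec ex_upto :: "nat \<Rightarrow> 'p fm \<Rightarrow> 'p fm" where
  "ex_upto 0 \<phi> = \<phi>"
| "ex_upto (Suc m) \<phi> = Ex (Suc m) (ex_upto m \<phi>)"

lemma ex_upto_simps [simp]:
  "fsize (ex_upto m \<phi>) = m + fsize \<phi>"
  "free_vars (ex_upto m \<phi>) = free_vars \<phi> - {1..m}"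
  "set_fm (ex_upto m \<phi>) = set_fm \<phi>"
  by (induction m) (auto simp: le_Suc_eq)

lemma sat_ex_upto:
  "sat n N s (ex_upto m \<phi>) \<longleftrightarrow>
    (\<exists>t. t ` {1..m} \<subseteq> {1..n} \<and> (\<forall>i. i \<notin> {1..m} \<longrightarrow> t i = s i) \<and> sat n N t \<phi>)"
proof (induction m arbitrary: s)
  case 0
  have "t = s" if "\<forall>i. t i = s i" for t using that by auto
  then show ?case by auto
next
  case (Suc m)
  show ?case
  proof
    assume "sat n N s (ex_upto (Suc m) \<phi>)"
    then obtain a t where "a \<in> {1..n}" "t ` {1..m} \<subseteq> {1..n}"
      "\<forall>i. i \<notin> {1..m} \<longrightarrow> t i = (s(Suc m := a)) i" "sat n N t \<phi>"
      using Suc by auto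
    then show "\<exists>t. t ` {1..Suc m} \<subseteq> {1..n} \<and> (\<forall>i. i \<notin> {1..Suc m} \<longrightarrow> t i = s i) \<and> sat n N t \<phi>"
      by (intro exI[of _ t]) (auto simp: le_Suc_eq image_subset_iff)
  next
    assume "\<exists>t. t ` {1..Suc m} \<subseteq> {1..n} \<and> (\<forall>i. i \<notin> {1..Suc m} \<longrightarrow> t i = s i) \<and> sat n N t \<phi>"
    then obtain t where t: "t ` {1..Suc m} \<subseteq> {1..n}" "\<forall>i. i \<notin> {1..Suc m} \<longrightarrow> t i = s i" "sat n N t \<phi>"
      by blast
    then have "sat n N (s(Suc m := t (Suc m))) (ex_upto m \<phi>)"
      unfolding Suc by (intro exI[of _ t]) (auto simp: le_Suc_eq image_subset_iff)
    with t(1) show "sat n N s (ex_upto (Suc m) \<phi>)" by (auto simp: image_subset_iff)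
  qed
qed

text \<open>The points \<open>t i\<close> may repeat and may lie outside \<open>A\<close>, so a
  covering by \<open>m\<close> points exists for every smaller cardinality too. The condition
  outside \<open>{1..m}\<close> matches the semantics of \<open>ex_upto\<close>.\<close>

lemma card_le_iff_covered:
  assumes "finite A" "A \<subseteq> B" "B \<noteq> {}"
  shows "card A \<le> m \<longleftrightarrow>
    (\<exists>t. t ` {1..m} \<subseteq> B \<and> (\<forall>i. i \<notin> {1..m} \<longrightarrow> t i = s i) \<and> A \<subseteq> t ` {1..m})"
proof
  assume "card A \<le> m"
  then have "card A \<le> card {1..m}" by simp
  then obtain f where f: "f ` A \<subseteq> {1..m}" "inj_on f A"
    using card_le_inj[OF assms(1), of "{1..m}"] by auto
  obtain b where "b \<in> B" using assms by auto
  \<comment> \<open>A left inverse of the injection \<open>f\<close>; indices that \<open>f\<close>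
    misses go to the spare point \<open>b\<close>.\<close>
  define t where "t i = (if i \<in> {1..m} then if i \<in> f ` A then inv_into A f i else b else s i)" for i
  have "t (f a) = a" if "a \<in> A" for a
    using that f by (auto simp: t_def)
  then have "A \<subseteq> t ` {1..m}" using f(1) by (metis image_subset_iff rev_image_eqI subsetI)
  moreover have "t ` {1..m} \<subseteq> B"
    using assms \<open>b \<in> B\<close> inv_into_into[of _ f A] by (auto simp: t_def)
  moreover have "\<forall>i. i \<notin> {1..m} \<longrightarrow> t i = s i" by (simp add: t_def)
  ultimately show "\<exists>t. t ` {1..m} \<subseteq> B \<and> (\<forall>i. i \<notin> {1..m} \<longrightarrow> t i = s i) \<and> A \<subseteq> t ` {1..m}"
    by blast
next
  assume "\<exists>t. t ` {1..m} \<subseteq> B \<and> (\<forall>i. i \<notin> {1..m} \<longrightarrow> t i = s i) \<and> A \<subseteq> t ` {1..m}"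
  then obtain t where "A \<subseteq> t ` {1..m}" by blast
  then have "card A \<le> card (t ` {1..m})" by (intro card_mono) auto
  also have "\<dots> \<le> m" using card_image_le[of "{1..m}" t] by simp
  finally show "card A \<le> m" .
qed

text \<open>The elements of type \<open>\<pi>\<close> are covered by \<open>m\<close> existentially quantified points; the negation
  then says that there are more than \<open>m\<close> of them. Covering replaces the quadratically many
  inequalities of the usual counting quantifier.\<close>

definition at_most :: "'p list \<Rightarrow> 'p set \<Rightarrow> nat \<Rightarrow> 'p fm" where
  "at_most Ps \<pi> m = ex_upto m (All 0 (foldr Disj
     (map (\<lambda>P. if P \<in> \<pi> then NRel P 0 else Rel P 0) Ps @ map (Eq 0) [1..<Suc m]) (NEq 0 0)))"

text \<open>Each covering point costs a quantifier, an equation and a disjunction, hence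
  \<open>3 * m\<close>; each predicate costs a literal and a disjunction. The last \<open>2\<close>
  is the universal quantifier and \<open>NEq 0 0\<close>, the false end of the disjunction.\<close>

lemma at_most_simps:
  "fsize (at_most Ps \<pi> m) = 3 * m + 2 * length Ps + 2"
  "free_vars (at_most Ps \<pi> m) = {}"
  "set_fm (at_most Ps \<pi> m) \<subseteq> set Ps"
proof -
  have "(\<Sum>P\<leftarrow>Ps. fsize (if P \<in> \<pi> then NRel P 0 else Rel P 0) + 1) = 2 * length Ps"
    by (induction Ps) auto
  then show "fsize (at_most Ps \<pi> m) = 3 * m + 2 * length Ps + 2"
    by (simp add: at_most_def foldr_Disj_simps o_def sum_list_triv del: upt_Suc)
  show "free_vars (at_most Ps \<pi> m) = {}" "set_fm (at_most Ps \<pi> m) \<subseteq> set Ps"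
    by (auto simp: at_most_def foldr_Disj_simps split: if_splits simp del: upt_Suc)
qed

lemma sat_at_most:
  assumes "1 \<le> n" "\<pi> \<subseteq> set Ps"
  shows "sat n N s (at_most Ps \<pi> m) \<longleftrightarrow> type_count (set Ps) n N \<pi> \<le> m"
proof -
  let ?A = "{a \<in> {1..n}. elem_type (set Ps) N a = \<pi>}"
  have lit: "(\<exists>P\<in>set Ps. sat n N t (if P \<in> \<pi> then NRel P 0 else Rel P 0)) \<longleftrightarrow>
      elem_type (set Ps) N (t 0) \<noteq> \<pi>" for t
  proof -
    have "sat n N t (if P \<in> \<pi> then NRel P 0 else Rel P 0) \<longleftrightarrow> (P \<in> \<pi> \<longleftrightarrow> t 0 \<notin> N P)" for P by auto
    then show ?thesis using assms(2) by (auto simp: elem_type_def)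
  qed
  have body: "sat n N t (All 0 (foldr Disj
     (map (\<lambda>P. if P \<in> \<pi> then NRel P 0 else Rel P 0) Ps @ map (Eq 0) [1..<Suc m]) (NEq 0 0)))
     \<longleftrightarrow> ?A \<subseteq> t ` {1..m}" for t
  proof -
    have eqs: "(\<exists>\<phi>\<in>Eq 0 ` set [1..<Suc m]. sat n N t' \<phi>) \<longleftrightarrow> t' 0 \<in> t' ` {1..m}" for t'
      unfolding set_upt atLeastLessThanSuc_atLeastAtMost by auto
    \<comment> \<open>Binding variable \<open>0\<close> does not move the covering points.\<close>
    have upd: "(t(0 := a)) ` {1..m} = t ` {1..m}" for a by (intro image_cong) auto
    show ?thesis
      unfolding sat.simps foldr_Disj_simps set_append bex_Un set_map eqs upd
      by (simp only: bex_simps lit) auto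
  qed
  show ?thesis
    unfolding at_most_def sat_ex_upto body type_count_eq
    using assms(1) by (intro card_le_iff_covered[symmetric]) auto
qed

text \<open>The case \<open>m = 0\<close> is separate because \<open>0 - 1 = 0\<close> on naturals
  would make the conjunction contradictory.\<close>

definition exactly :: "'p list \<Rightarrow> 'p set \<Rightarrow> nat \<Rightarrow> 'p fm" where
  "exactly Ps \<pi> m = (if m = 0 then at_most Ps \<pi> 0
     else Conj (at_most Ps \<pi> m) (neg (at_most Ps \<pi> (m - 1))))"

lemma exactly_simps:
  "fsize (exactly Ps \<pi> m) \<le> 6 * m + 4 * length Ps + 2"
  "free_vars (exactly Ps \<pi> m) = {}"
  "set_fm (exactly Ps \<pi> m) \<subseteq> set Ps"
  using at_most_simps(3)[of Ps \<pi>] by (auto simp: exactly_def at_most_simps(1,2) subset_iff)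

lemma sat_exactly:
  assumes "1 \<le> n" "\<pi> \<subseteq> set Ps"
  shows "sat n N s (exactly Ps \<pi> m) \<longleftrightarrow> type_count (set Ps) n N \<pi> = m"
  using sat_at_most[OF assms] by (auto simp: exactly_def sat_neg)

text \<open>The count of one type can be left out, since all counts add up to \<open>n\<close>.\<close>

lemma complexity_le:
  assumes "finite \<tau>" "tau_model \<tau> n M" "\<pi>\<^sub>0 \<subseteq> \<tau>"
  shows "complexity \<tau> n M \<le>
    6 * (n - type_count \<tau> n M \<pi>\<^sub>0) + (2 ^ card \<tau> - 1) * (4 * card \<tau> + 3) + 2"
proof -
  have n: "1 \<le> n" using assms(2) by (simp add: tau_model_def)
  obtain Ps where Ps: "set Ps = \<tau>" "distinct Ps" using finite_distinct_list[OF assms(1)] by blast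
  have len: "length Ps = card \<tau>" using Ps distinct_card by fastforce
  obtain ts where ts: "set ts = Pow \<tau> - {\<pi>\<^sub>0}" "distinct ts"
    using finite_distinct_list[of "Pow \<tau> - {\<pi>\<^sub>0}"] assms(1) by auto
  \<comment> \<open>\<open>All 0 (Eq 0 0)\<close> is a valid sentence of size 2 that ends the
    conjunction.\<close>
  define \<phi> where "\<phi> = foldr Conj (map (\<lambda>\<pi>. exactly Ps \<pi> (type_count \<tau> n M \<pi>)) ts) (All 0 (Eq 0 0))"
  have split: "n = type_count \<tau> n K \<pi>\<^sub>0 + (\<Sum>\<pi>\<in>Pow \<tau> - {\<pi>\<^sub>0}. type_count \<tau> n K \<pi>)" for K
    using sum_type_count[OF assms(1), of n K] assms by (simp add: sum.remove[of "Pow \<tau>" \<pi>\<^sub>0])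
  have "sentence \<tau> \<phi>"
    using exactly_simps(3)[of Ps] Ps(1)
    by (force simp: sentence_def \<phi>_def foldr_Conj_simps exactly_simps(2))
  moreover have "true_in n N \<phi> \<longleftrightarrow> isomorphic \<tau> n M N" for N
  proof -
    have "sat n N s \<phi> \<longleftrightarrow> (\<forall>\<pi>\<in>Pow \<tau> - {\<pi>\<^sub>0}. type_count \<tau> n N \<pi> = type_count \<tau> n M \<pi>)" for s
      using sat_exactly[OF n, of _ Ps] Ps(1) ts(1) by (auto simp: \<phi>_def foldr_Conj_simps)
    then have "true_in n N \<phi> \<longleftrightarrow> (\<forall>\<pi>\<in>Pow \<tau> - {\<pi>\<^sub>0}. type_count \<tau> n N \<pi> = type_count \<tau> n M \<pi>)"
      \<comment> \<open>A constant assignment with value \<open>1\<close> shows that the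
        quantification over assignments is not vacuous.\<close>
      using n by (auto simp: true_in_def intro: exI[of _ "\<lambda>_. 1"])
    also have "\<dots> \<longleftrightarrow> (\<forall>\<pi>\<in>Pow \<tau>. type_count \<tau> n N \<pi> = type_count \<tau> n M \<pi>)"
    proof
      assume eq: "\<forall>\<pi>\<in>Pow \<tau> - {\<pi>\<^sub>0}. type_count \<tau> n N \<pi> = type_count \<tau> n M \<pi>"
      then have "(\<Sum>\<pi>\<in>Pow \<tau> - {\<pi>\<^sub>0}. type_count \<tau> n N \<pi>) = (\<Sum>\<pi>\<in>Pow \<tau> - {\<pi>\<^sub>0}. type_count \<tau> n M \<pi>)"
        by (intro sum.cong) auto
      then have "type_count \<tau> n N \<pi>\<^sub>0 = type_count \<tau> n M \<pi>\<^sub>0"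
        using split[of N] split[of M] by linarith
      with eq show "\<forall>\<pi>\<in>Pow \<tau>. type_count \<tau> n N \<pi> = type_count \<tau> n M \<pi>" by blast
    qed blast
    finally show ?thesis using isomorphic_iff_type_count[OF assms(1)] by blast
  qed
  ultimately have "complexity \<tau> n M \<le> fsize \<phi>"
    unfolding complexity_def describes_def by (intro Least_le) blast
  also have "fsize \<phi> = (\<Sum>\<pi>\<leftarrow>ts. fsize (exactly Ps \<pi> (type_count \<tau> n M \<pi>)) + 1) + 2"
    by (simp add: \<phi>_def foldr_Conj_simps o_def)
  also have "(\<Sum>\<pi>\<leftarrow>ts. fsize (exactly Ps \<pi> (type_count \<tau> n M \<pi>)) + 1) =
      (\<Sum>\<pi>\<in>Pow \<tau> - {\<pi>\<^sub>0}. fsize (exactly Ps \<pi> (type_count \<tau> n M \<pi>)) + 1)"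
    using ts by (metis sum_list_distinct_conv_sum_set)
  \<comment> \<open>The additive \<open>3\<close> consists of the \<open>2\<close> in the size of
    \<open>exactly\<close> and one conjunction joining it to the rest.\<close>
  also have "\<dots> \<le> (\<Sum>\<pi>\<in>Pow \<tau> - {\<pi>\<^sub>0}. 6 * type_count \<tau> n M \<pi> + (4 * card \<tau> + 3))"
  proof (rule sum_mono)
    fix \<pi>
    show "fsize (exactly Ps \<pi> (type_count \<tau> n M \<pi>)) + 1 \<le> 6 * type_count \<tau> n M \<pi> + (4 * card \<tau> + 3)"
      using exactly_simps(1)[of Ps \<pi> "type_count \<tau> n M \<pi>"] len by simp
  qed
  also have "\<dots> = 6 * (\<Sum>\<pi>\<in>Pow \<tau> - {\<pi>\<^sub>0}. type_count \<tau> n M \<pi>) + (2 ^ card \<tau> - 1) * (4 * card \<tau> + 3)"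
    unfolding sum.distrib sum_distrib_left[symmetric] using assms
    by (simp add: card_Diff_singleton card_Pow algebra_simps)
  also have "(\<Sum>\<pi>\<in>Pow \<tau> - {\<pi>\<^sub>0}. type_count \<tau> n M \<pi>) = n - type_count \<tau> n M \<pi>\<^sub>0"
    using split[of M] by linarith
  finally show ?thesis by simp
qed

section \<open>From the entropy bound to the complexity bound\<close>

theorem theorem8:
  fixes \<tau> :: "'p set" and n :: nat and M :: "'p \<Rightarrow> nat set" and p :: real
  assumes "finite \<tau>"
    and "\<tau> \<noteq> {}"
    and "tau_model \<tau> n M"
    and "0 \<le> p" and "p \<le> 1 / 2"
    and "entropy \<tau> n M < (p - 1) * log 2 (1 - p) - p * log 2 p"
  shows "real (complexity \<tau> n M) < 6 * real n * p + real (vocab_const \<tau>)"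
proof -
  have n: "0 < n" using assms(3) by (simp add: tau_model_def)
  let ?c = "type_count \<tau> n M"
  have fin: "finite (Pow \<tau>)" using assms(1) by simp
  obtain \<pi>\<^sub>0 where \<pi>\<^sub>0: "\<pi>\<^sub>0 \<in> Pow \<tau>" "\<And>\<pi>. \<pi> \<in> Pow \<tau> \<Longrightarrow> ?c \<pi> \<le> ?c \<pi>\<^sub>0"
  proof -
    have "Max (?c ` Pow \<tau>) \<in> ?c ` Pow \<tau>" using fin by (intro Max_in) auto
    then obtain \<pi> where "\<pi> \<in> Pow \<tau>" "?c \<pi> = Max (?c ` Pow \<tau>)" by auto
    with that fin show thesis by (metis Max_ge finite_imageI imageI)
  qed
  have total: "(\<Sum>\<pi>\<in>Pow \<tau>. real (?c \<pi>)) = real n"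
    using sum_type_count[OF assms(1), of n M] by (metis of_nat_sum)
  have "1 - real (?c \<pi>\<^sub>0) / real n < p"
  proof (rule entropy_less_imp_mode_large[where f = "\<lambda>\<pi>. real (?c \<pi>) / real n"])
    show "(\<Sum>\<pi>\<in>Pow \<tau>. real (?c \<pi>) / real n) = 1"
      using total n by (simp flip: sum_divide_distrib)
    \<comment> \<open>The right-hand side of the hypothesis is the binary entropy of
      \<open>p\<close> with its signs rearranged.\<close>
    show "(\<Sum>\<pi>\<in>Pow \<tau>. - (real (?c \<pi>) / real n) * log 2 (real (?c \<pi>) / real n)) < binary_entropy p"
      using assms(6) by (simp add: entropy_def binary_entropy_def algebra_simps)
  qed (use fin \<pi>\<^sub>0 assms n in \<open>auto intro: divide_right_mono\<close>)
  then have "real n - real (?c \<pi>\<^sub>0) < real n * p" using n by (simp add: field_simps)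
  moreover have "?c \<pi>\<^sub>0 \<le> n"
    using member_le_sum[OF \<pi>\<^sub>0(1), of ?c] fin sum_type_count[OF assms(1), of n M] by simp
  ultimately have outside: "6 * real (n - ?c \<pi>\<^sub>0) < 6 * real n * p" by (simp add: of_nat_diff)
  have "(2 ^ card \<tau> - 1) * (4 * card \<tau> + 3) + 2 \<le> 2 ^ card \<tau> * (4 * card \<tau> + 3) + 2 ^ card \<tau> * 2"
    by (intro add_mono mult_right_mono) auto
  also have "\<dots> = 2 ^ card \<tau> * (4 * card \<tau> + 5)" by (simp add: algebra_simps)
  \<comment> \<open>A nonempty vocabulary has \<open>card \<tau> \<ge> 1\<close>, so the constant
    \<open>5\<close> is absorbed into a multiple of \<open>card \<tau>\<close>.\<close>
  also have "\<dots> \<le> 2 ^ card \<tau> * (15 * card \<tau>)"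
    using assms(1,2) card_gt_0_iff[of \<tau>] by (intro mult_left_mono) auto
  finally have "(2 ^ card \<tau> - 1) * (4 * card \<tau> + 3) + 2 \<le> vocab_const \<tau>"
    by (simp add: vocab_const_def mult_ac)
  then have "complexity \<tau> n M \<le> 6 * (n - ?c \<pi>\<^sub>0) + vocab_const \<tau>"
    using complexity_le[OF assms(1,3), of \<pi>\<^sub>0] \<pi>\<^sub>0(1) by simp
  then have "real (complexity \<tau> n M) \<le> 6 * real (n - ?c \<pi>\<^sub>0) + real (vocab_const \<tau>)"
    by (metis (mono_tags) of_nat_add of_nat_le_iff of_nat_mult of_nat_numeral)
  with outside show ?thesis by linarith
qed

end
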